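(* Let $P:\mathcal{C}^{op}\to\mathbf{InfSL}$ be an elementary doctrine. If $P$ has comprehensions, then $(P)_q$ has comprehensions. Moreover, given a comprehension $c:X\to A$ of $\alpha$ in $P(A)$, the map $J(c):JX\to JA$ is a comprehension of $j_A(\alpha)$ if and only if $\delta_X=P_{c\times c}(\delta_A)$.
   Context: $\mathbf{InfSL}$ is the category of inf-semilattices (with top element $\top$) and homomorphisms. An elementary doctrine is a functor $P:\mathcal{C}^{op}\to\mathbf{InfSL}$, $\mathcal{C}$ a category with binary products (the action of $P$ on an arrow $f$ is written $P_f$), such that for every object $A$ of $\mathcal{C}$ there is $\delta_A\in P(A\times A)$ with: (i) $\alpha\mapsto P_{pr_1}(\alpha)\wedge\delta_A$, for $\alpha\in P(A)$, is left adjoint to $P_{\langle id_A,id_A\rangle}:P(A\times A)\to P(A)$; (ii) for every map $e=\langle pr_1,pr_2,pr_2\rangle:X\times A\to X\times A\times A$, the assignment $\alpha\mapsto P_{\langle pr_1,pr_2\rangle}(\alpha)\wedge P_{\langle pr_2,pr_3\rangle}(\delta_A)$, for $\alpha\in P(X\times A)$, is left adjoint to $P_e:P(X\times A\times A)\to P(X\times A)$. A comprehension of $\alpha\in P(A)$ is a map $c:X\to A$ with $P_c(\alpha)=\top_X$ such that for every $f:Z\to A$ with $P_f(\alpha)=\top_Z$ there is a unique $g:Z\to X$ with $f=c\circ g$. $P$ has comprehensions if every $\alpha$ (in every $P(A)$) has a comprehension. A $P$-equivalence relation on $A$ is $\rho\in P(A\times A)$ with $\delta_A\le\rho$; $\rho\le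 P_{\langle pr_2,pr_1\rangle}(\rho)$; and $P_{\langle pr_1,pr_2\rangle}(\rho)\wedge P_{\langle pr_2,pr_3\rangle}(\rho)\le P_{\langle pr_1,pr_3\rangle}(\rho)$ in $P(A\times A\times A)$. $\mathcal{D}es_\rho$ is the sub-poset of $P(A)$ of those $\alpha$ with $P_{pr_1}(\alpha)\wedge\rho\le P_{pr_2}(\alpha)$ in $P(A\times A)$. The category $\mathcal{R}_P$ has as objects pairs $(A,\rho)$ with $\rho$ a $P$-equivalence relation on $A$; an arrow $f:(A,\rho)\to(B,\sigma)$ is an arrow $f:A\to B$ of $\mathcal{C}$ with $\rho\le P_{f\times f}(\sigma)$; composition and identities are those of $\mathcal{C}$. The elementary doctrine $(P)_q:\mathcal{R}_P^{op}\to\mathbf{InfSL}$ is $(P)_q(A,\rho)=\mathcal{D}es_\rho$, acting on an arrow $f$ by restriction of $P_f$. $J:\mathcal{C}\to\mathcal{R}_P$ is the functor $J(A)=(A,\delta_A)$, $J(f)=f$, and $j_A:P(A)\to(P)_q(A,\delta_A)=\mathcal{D}es_{\delta_A}=P(A)$ is the identity. *)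

theory Defs
  imports "HOL-Algebra.Galois_Connection"
begin

section \<open>Categories with binary products\<close>

record ('o, 'm) category =
  Obj :: "'o set"
  Arr :: "'m set"
  Dom :: "'m \<Rightarrow> 'o"
  Cod :: "'m \<Rightarrow> 'o"
  Ident :: "'o \<Rightarrow> 'm"
  Comp :: "'m \<Rightarrow> 'm \<Rightarrow> 'm" (infixl \<open>\<cdot>\<index>\<close> 70)

definition Hom :: "('o, 'm, 'z) category_scheme \<Rightarrow> 'o \<Rightarrow> 'o \<Rightarrow> 'm set" where
  "Hom C A B = {f \<in> Arr C. Dom C f = A \<and> Cod C f = B}"

locale category =
  fixes C :: "('o, 'm, 'z) category_scheme" (structure)
  assumes Dom_Obj: "f \<in> Arr C \<Longrightarrow> Dom C f \<in> Obj C"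
    and Cod_Obj: "f \<in> Arr C \<Longrightarrow> Cod C f \<in> Obj C"
    and Ident_Hom: "A \<in> Obj C \<Longrightarrow> Ident C A \<in> Hom C A A"
    and Comp_Hom: "\<lbrakk>f \<in> Hom C A B; g \<in> Hom C B D\<rbrakk> \<Longrightarrow> g \<cdot> f \<in> Hom C A D"
    and Comp_Ident_right: "f \<in> Hom C A B \<Longrightarrow> f \<cdot> Ident C A = f"
    and Comp_Ident_left: "f \<in> Hom C A B \<Longrightarrow> Ident C B \<cdot> f = f"
    and Comp_assoc: "\<lbrakk>f \<in> Hom C A B; g \<in> Hom C B D; h \<in> Hom C D E\<rbrakk>
          \<Longrightarrow> (h \<cdot> g) \<cdot> f = h \<cdot> (g \<cdot> f)"

text \<open>Binary products are given by a choice of product diagrams.\<close>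

record ('o, 'm) product_category = "('o, 'm) category" +
  Prod :: "'o \<Rightarrow> 'o \<Rightarrow> 'o"
  Pr1 :: "'o \<Rightarrow> 'o \<Rightarrow> 'm"
  Pr2 :: "'o \<Rightarrow> 'o \<Rightarrow> 'm"

definition is_product ::
    "('o, 'm, 'z) category_scheme \<Rightarrow> 'o \<Rightarrow> 'o \<Rightarrow> 'o \<Rightarrow> 'm \<Rightarrow> 'm \<Rightarrow> bool" where
  "is_product C A B Q p q \<longleftrightarrow>
     p \<in> Hom C Q A \<and> q \<in> Hom C Q B \<and>
     (\<forall>Z \<in> Obj C. \<forall>f \<in> Hom C Z A. \<forall>g \<in> Hom C Z B.
        \<exists>!h. h \<in> Hom C Z Q \<and> p \<cdot>\<^bsub>C\<^esub> h = f \<and> q \<cdot>\<^bsub>C\<^esub> h = g)"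

locale product_category = category C
  for C :: "('o, 'm, 'z) product_category_scheme" (structure) +
  assumes product: "\<lbrakk>A \<in> Obj C; B \<in> Obj C\<rbrakk>
      \<Longrightarrow> is_product C A B (Prod C A B) (Pr1 C A B) (Pr2 C A B)"

definition pair :: "('o, 'm, 'z) product_category_scheme \<Rightarrow> 'm \<Rightarrow> 'm \<Rightarrow> 'm"
    (\<open>\<langle>_, _\<rangle>\<index>\<close>) where
  "\<langle>f, g\<rangle>\<^bsub>C\<^esub> = (THE h. h \<in> Hom C (Dom C f) (Prod C (Cod C f) (Cod C g)) \<and>
      Pr1 C (Cod C f) (Cod C g) \<cdot>\<^bsub>C\<^esub> h = f \<and> Pr2 C (Cod C f) (Cod C g) \<cdot>\<^bsub>C\<^esub> h = g)"

definition cross :: "('o, 'm, 'z) product_category_scheme \<Rightarrow> 'm \<Rightarrow> 'm \<Rightarrow> 'm" where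
  "cross C f g = \<langle>f \<cdot>\<^bsub>C\<^esub> Pr1 C (Dom C f) (Dom C g), g \<cdot>\<^bsub>C\<^esub> Pr2 C (Dom C f) (Dom C g)\<rangle>\<^bsub>C\<^esub>"

definition diag :: "('o, 'm, 'z) product_category_scheme \<Rightarrow> 'o \<Rightarrow> 'm" where
  "diag C A = \<langle>Ident C A, Ident C A\<rangle>\<^bsub>C\<^esub>"

definition swap :: "('o, 'm, 'z) product_category_scheme \<Rightarrow> 'o \<Rightarrow> 'm" where
  "swap C A = \<langle>Pr2 C A A, Pr1 C A A\<rangle>\<^bsub>C\<^esub>"

text \<open>The ternary product \<open>A \<times> B \<times> D\<close> is read as \<open>(A \<times> B) \<times> D\<close>.\<close>

definition Prod3 :: "('o, 'm, 'z) product_category_scheme \<Rightarrow> 'o \<Rightarrow> 'o \<Rightarrow> 'o \<Rightarrow> 'o" where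
  "Prod3 C A B D = Prod C (Prod C A B) D"

definition Pr1_3 :: "('o, 'm, 'z) product_category_scheme \<Rightarrow> 'o \<Rightarrow> 'o \<Rightarrow> 'o \<Rightarrow> 'm" where
  "Pr1_3 C A B D = Pr1 C A B \<cdot>\<^bsub>C\<^esub> Pr1 C (Prod C A B) D"

definition Pr2_3 :: "('o, 'm, 'z) product_category_scheme \<Rightarrow> 'o \<Rightarrow> 'o \<Rightarrow> 'o \<Rightarrow> 'm" where
  "Pr2_3 C A B D = Pr2 C A B \<cdot>\<^bsub>C\<^esub> Pr1 C (Prod C A B) D"

definition Pr3_3 :: "('o, 'm, 'z) product_category_scheme \<Rightarrow> 'o \<Rightarrow> 'o \<Rightarrow> 'o \<Rightarrow> 'm" where
  "Pr3_3 C A B D = Pr2 C (Prod C A B) D"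

section \<open>Doctrines\<close>

locale inf_semilattice = lower_semilattice L + weak_partial_order_top L
  for L :: "('p, 'z) gorder_scheme" (structure)

definition infsl_hom :: "('p, 'y) gorder_scheme \<Rightarrow> ('q, 'z) gorder_scheme \<Rightarrow> ('p \<Rightarrow> 'q) set" where
  "infsl_hom L M = {h \<in> carrier L \<rightarrow> carrier M.
     h \<top>\<^bsub>L\<^esub> = \<top>\<^bsub>M\<^esub> \<and>
     (\<forall>x \<in> carrier L. \<forall>y \<in> carrier L. h (x \<sqinter>\<^bsub>L\<^esub> y) = h x \<sqinter>\<^bsub>M\<^esub> h y)}"

text \<open>\<open>Fib P A\<close> is \<open>P(A)\<close>, and \<open>Act P f\<close> is the action \<open>P\<^sub>f : P(B) \<rightarrow> P(A)\<close> of \<open>f : A \<rightarrow> B\<close>;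
  only its values on the carrier of \<open>P(B)\<close> are meaningful.\<close>

record ('o, 'm, 'p) doctrine =
  Fib :: "'o \<Rightarrow> 'p gorder"
  Act :: "'m \<Rightarrow> 'p \<Rightarrow> 'p"

locale infsl_functor = category C
  for C :: "('o, 'm, 'z) category_scheme" (structure) +
  fixes P :: "('o, 'm, 'p) doctrine"
  assumes Fib_infsl: "A \<in> Obj C \<Longrightarrow> inf_semilattice (Fib P A)"
    and Act_hom: "f \<in> Hom C A B \<Longrightarrow> Act P f \<in> infsl_hom (Fib P B) (Fib P A)"
    and Act_Ident: "\<lbrakk>A \<in> Obj C; \<alpha> \<in> carrier (Fib P A)\<rbrakk> \<Longrightarrow> Act P (Ident C A) \<alpha> = \<alpha>"
    and Act_Comp: "\<lbrakk>f \<in> Hom C A B; g \<in> Hom C B D; \<alpha> \<in> carrier (Fib P D)\<rbrakk>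
          \<Longrightarrow> Act P (g \<cdot> f) \<alpha> = Act P f (Act P g \<alpha>)"

text \<open>In a Galois connection, \<open>lower\<close> is the left adjoint. The elements \<open>\<delta>\<^sub>A\<close> are determined by
  the first adjunction (as the image of the top element), so they are made a parameter.\<close>

locale elementary_doctrine = product_category C + infsl_functor C P
  for C :: "('o, 'm, 'z) product_category_scheme" (structure)
    and P :: "('o, 'm, 'p) doctrine" +
  fixes \<delta> :: "'o \<Rightarrow> 'p"
  assumes delta_closed: "A \<in> Obj C \<Longrightarrow> \<delta> A \<in> carrier (Fib P (Prod C A A))"
    and adjoint_diag: "A \<in> Obj C \<Longrightarrow> galois_connection
        \<lparr> orderA = Fib P A,
          orderB = Fib P (Prod C A A),
          lower = (\<lambda>\<alpha>. Act P (Pr1 C A A) \<alpha> \<sqinter>\<^bsub>Fib P (Prod C A A)\<^esub> \<delta> A),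
          upper = Act P (diag C A) \<rparr>"
    and adjoint_diag_param: "\<lbrakk>X \<in> Obj C; A \<in> Obj C\<rbrakk> \<Longrightarrow> galois_connection
        \<lparr> orderA = Fib P (Prod C X A),
          orderB = Fib P (Prod3 C X A A),
          lower = (\<lambda>\<alpha>. Act P \<langle>Pr1_3 C X A A, Pr2_3 C X A A\<rangle> \<alpha>
                     \<sqinter>\<^bsub>Fib P (Prod3 C X A A)\<^esub> Act P \<langle>Pr2_3 C X A A, Pr3_3 C X A A\<rangle> (\<delta> A)),
          upper = Act P \<langle>\<langle>Pr1 C X A, Pr2 C X A\<rangle>, Pr2 C X A\<rangle> \<rparr>"

section \<open>Comprehensions\<close>

definition is_comprehension ::
    "('o, 'm, 'z) category_scheme \<Rightarrow> ('o, 'm, 'p) doctrine \<Rightarrow> 'o \<Rightarrow> 'p \<Rightarrow> 'o \<Rightarrow> 'm \<Rightarrow> bool" where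
  "is_comprehension C P A \<alpha> X c \<longleftrightarrow>
     A \<in> Obj C \<and> \<alpha> \<in> carrier (Fib P A) \<and> c \<in> Hom C X A \<and>
     Act P c \<alpha> = \<top>\<^bsub>Fib P X\<^esub> \<and>
     (\<forall>Z f. f \<in> Hom C Z A \<and> Act P f \<alpha> = \<top>\<^bsub>Fib P Z\<^esub> \<longrightarrow>
        (\<exists>!g. g \<in> Hom C Z X \<and> f = c \<cdot>\<^bsub>C\<^esub> g))"

definition has_comprehensions ::
    "('o, 'm, 'z) category_scheme \<Rightarrow> ('o, 'm, 'p) doctrine \<Rightarrow> bool" where
  "has_comprehensions C P \<longleftrightarrow>
     (\<forall>A \<in> Obj C. \<forall>\<alpha> \<in> carrier (Fib P A). \<exists>X c. is_comprehension C P A \<alpha> X c)"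

section \<open>Equivalence relations, descent data, and quotients\<close>

definition is_P_equivalence ::
    "('o, 'm, 'z) product_category_scheme \<Rightarrow> ('o, 'm, 'p) doctrine \<Rightarrow> ('o \<Rightarrow> 'p) \<Rightarrow> 'o \<Rightarrow> 'p \<Rightarrow> bool"
  where
  "is_P_equivalence C P \<delta> A \<rho> \<longleftrightarrow>
     \<rho> \<in> carrier (Fib P (Prod C A A)) \<and>
     \<delta> A \<sqsubseteq>\<^bsub>Fib P (Prod C A A)\<^esub> \<rho> \<and>
     \<rho> \<sqsubseteq>\<^bsub>Fib P (Prod C A A)\<^esub> Act P (swap C A) \<rho> \<and>
     Act P \<langle>Pr1_3 C A A A, Pr2_3 C A A A\<rangle>\<^bsub>C\<^esub> \<rho>
       \<sqinter>\<^bsub>Fib P (Prod3 C A A A)\<^esub> Act P \<langle>Pr2_3 C A A A, Pr3_3 C A A A\<rangle>\<^bsub>C\<^esub> \<rho>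
       \<sqsubseteq>\<^bsub>Fib P (Prod3 C A A A)\<^esub> Act P \<langle>Pr1_3 C A A A, Pr3_3 C A A A\<rangle>\<^bsub>C\<^esub> \<rho>"

definition Des ::
    "('o, 'm, 'z) product_category_scheme \<Rightarrow> ('o, 'm, 'p) doctrine \<Rightarrow> 'o \<Rightarrow> 'p \<Rightarrow> 'p gorder" where
  "Des C P A \<rho> = (Fib P A)\<lparr> carrier := {\<alpha> \<in> carrier (Fib P A).
     Act P (Pr1 C A A) \<alpha> \<sqinter>\<^bsub>Fib P (Prod C A A)\<^esub> \<rho>
       \<sqsubseteq>\<^bsub>Fib P (Prod C A A)\<^esub> Act P (Pr2 C A A) \<alpha>} \<rparr>"

text \<open>An arrow of \<open>C\<close> may underlie several arrows of \<open>\<R>\<^sub>P\<close>, so an arrow of \<open>\<R>\<^sub>P\<close> is a triple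
  (domain, underlying arrow, codomain).\<close>

definition RCat ::
    "('o, 'm, 'z) product_category_scheme \<Rightarrow> ('o, 'm, 'p) doctrine \<Rightarrow> ('o \<Rightarrow> 'p) \<Rightarrow>
     ('o \<times> 'p, ('o \<times> 'p) \<times> 'm \<times> ('o \<times> 'p)) category" where
  "RCat C P \<delta> =
     \<lparr> Obj = {(A, \<rho>). A \<in> Obj C \<and> is_P_equivalence C P \<delta> A \<rho>},
       Arr = {((A, \<rho>), f, (B, \<sigma>)) | A \<rho> f B \<sigma>.
                A \<in> Obj C \<and> is_P_equivalence C P \<delta> A \<rho> \<and>
                B \<in> Obj C \<and> is_P_equivalence C P \<delta> B \<sigma> \<and>
                f \<in> Hom C A B \<and> \<rho> \<sqsubseteq>\<^bsub>Fib P (Prod C A A)\<^esub> Act P (cross C f f) \<sigma>},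
       Dom = (\<lambda>(a, f, b). a),
       Cod = (\<lambda>(a, f, b). b),
       Ident = (\<lambda>(A, \<rho>). ((A, \<rho>), Ident C A, (A, \<rho>))),
       Comp = (\<lambda>(b, g, d) (a, f, b'). (a, g \<cdot>\<^bsub>C\<^esub> f, d)) \<rparr>"

text \<open>The doctrine \<open>(P)\<^sub>q\<close> on \<open>\<R>\<^sub>P\<close>. Restricting \<open>P\<^sub>f\<close> to \<open>\<D>es\<^sub>\<sigma>\<close> leaves the HOL function unchanged.\<close>

definition Pq ::
    "('o, 'm, 'z) product_category_scheme \<Rightarrow> ('o, 'm, 'p) doctrine \<Rightarrow>
     ('o \<times> 'p, ('o \<times> 'p) \<times> 'm \<times> ('o \<times> 'p), 'p) doctrine" where
  "Pq C P = \<lparr> Fib = (\<lambda>(A, \<rho>). Des C P A \<rho>), Act = (\<lambda>(a, f, b). Act P f) \<rparr>"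

definition J_obj :: "('o \<Rightarrow> 'p) \<Rightarrow> 'o \<Rightarrow> 'o \<times> 'p" where
  "J_obj \<delta> A = (A, \<delta> A)"

definition J_arr ::
    "('o, 'm, 'z) category_scheme \<Rightarrow> ('o \<Rightarrow> 'p) \<Rightarrow> 'm \<Rightarrow> ('o \<times> 'p) \<times> 'm \<times> ('o \<times> 'p)" where
  "J_arr C \<delta> f = (J_obj \<delta> (Dom C f), f, J_obj \<delta> (Cod C f))"

text \<open>The component \<open>j\<^sub>A : P(A) \<rightarrow> (P)\<^sub>q(J A)\<close>, an identity.\<close>

definition j_map :: "'o \<Rightarrow> 'p \<Rightarrow> 'p" where
  "j_map A \<alpha> = \<alpha>"

end

theory Submission
  imports Defs
begin

text \<open>
  The whole argument rests on one construction: restriction of an equivalence relation \<open>\<rho>\<close> on \<open>A\<close>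
  along an arrow \<open>c : X \<rightarrow> A\<close>, that is, the relation \<open>P\<^bsub>c\<times>c\<^esub>(\<rho>)\<close> on \<open>X\<close>. It is the
  largest relation on \<open>X\<close> for which \<open>c\<close> is an arrow into \<open>(A, \<rho>)\<close>, and an arrow \<open>g : Z \<rightarrow> X\<close> is
  compatible with it exactly when \<open>c \<cdot> g\<close> is compatible with \<open>\<rho>\<close>. Hence, if \<open>c\<close> is a comprehension
  of a descent datum \<open>\<alpha>\<close> in \<open>\<C>\<close>, the factorisations through \<open>c\<close> that exist in \<open>\<C>\<close> are automatically
  arrows of \<open>\<R>\<^sub>P\<close> into \<open>(X, P\<^bsub>c\<times>c\<^esub>(\<rho>))\<close>, and \<open>c\<close> remains a comprehension there
  (\<open>comprehension_lift\<close>). This gives the first claim.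

  For the second claim, the case \<open>\<rho> = \<delta>\<^sub>A\<close> says that \<open>c : (X, P\<^bsub>c\<times>c\<^esub>(\<delta>\<^sub>A)) \<rightarrow> (A, \<delta>\<^sub>A)\<close> is a
  comprehension, which is \<open>J(c)\<close> as soon as \<open>\<delta>\<^sub>X = P\<^bsub>c\<times>c\<^esub>(\<delta>\<^sub>A)\<close>. Conversely, if \<open>J(c)\<close> is a
  comprehension, then \<open>c : (X, P\<^bsub>c\<times>c\<^esub>(\<delta>\<^sub>A)) \<rightarrow> (A, \<delta>\<^sub>A)\<close> factors through \<open>J(c)\<close>. Since \<open>c\<close> is monic,
  the factor can only be the identity of \<open>X\<close>, so \<open>P\<^bsub>c\<times>c\<^esub>(\<delta>\<^sub>A) \<le> \<delta>\<^sub>X\<close>; the reverse inequality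
  always holds because \<open>\<delta>\<^sub>X\<close> is the least reflexive relation on \<open>X\<close>.

  Inequalities \<open>\<delta>\<^sub>A \<le> \<beta>\<close> come from the adjunction for the diagonal, in the form
  \<open>\<top> \<le> P\<^bsub>diag\<^esub>(\<beta>)\<close>. Only transitivity of \<open>\<delta>\<^sub>A\<close> uses the parametrised adjunction. Relations are
  handled through generalised elements: for \<open>f, g : Z \<rightarrow> A\<close>, the element \<open>P\<^bsub>\<langle>f,g\<rangle>\<^esub>(\<rho>)\<close> of \<open>P(Z)\<close>
  plays the role of the formula \<open>\<rho>(f, g)\<close>.
\<close>

section \<open>Generalised elements of products\<close>

lemma (in category) Hom_Obj:
  assumes "f \<in> Hom C A B"
  shows "A \<in> Obj C" "B \<in> Obj C"
  using assms Dom_Obj Cod_Obj by (auto simp: Hom_def)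

context product_category
begin

lemma Pr_Hom:
  assumes "A \<in> Obj C" "B \<in> Obj C"
  shows "Pr1 C A B \<in> Hom C (Prod C A B) A" "Pr2 C A B \<in> Hom C (Prod C A B) B"
  using product[OF assms] by (auto simp: is_product_def)

lemma Prod_Obj: "\<lbrakk>A \<in> Obj C; B \<in> Obj C\<rbrakk> \<Longrightarrow> Prod C A B \<in> Obj C"
  using Pr_Hom(1) Hom_Obj(1) by blast

lemma product_ex1:
  assumes "f \<in> Hom C Z A" "g \<in> Hom C Z B"
  shows "\<exists>!h. h \<in> Hom C Z (Prod C A B) \<and> Pr1 C A B \<cdot> h = f \<and> Pr2 C A B \<cdot> h = g"
  using product[of A B] Hom_Obj[OF assms(1)] Hom_Obj[OF assms(2)] assms
  by (auto simp: is_product_def)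

lemma pair_Hom:
  assumes "f \<in> Hom C Z A" "g \<in> Hom C Z B"
  shows "\<langle>f, g\<rangle> \<in> Hom C Z (Prod C A B)"
    and Pr1_pair: "Pr1 C A B \<cdot> \<langle>f, g\<rangle> = f"
    and Pr2_pair: "Pr2 C A B \<cdot> \<langle>f, g\<rangle> = g"
proof -
  have "Dom C f = Z" "Cod C f = A" "Cod C g = B"
    using assms by (auto simp: Hom_def)
  then have "\<langle>f, g\<rangle> \<in> Hom C Z (Prod C A B) \<and> Pr1 C A B \<cdot> \<langle>f, g\<rangle> = f \<and> Pr2 C A B \<cdot> \<langle>f, g\<rangle> = g"
    using theI'[OF product_ex1[OF assms]] by (simp add: pair_def)
  then show "\<langle>f, g\<rangle> \<in> Hom C Z (Prod C A B)" "Pr1 C A B \<cdot> \<langle>f, g\<rangle> = f" "Pr2 C A B \<cdot> \<langle>f, g\<rangle> = g"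
    by auto
qed

lemma pair_unique:
  assumes "f \<in> Hom C Z A" "g \<in> Hom C Z B" "h \<in> Hom C Z (Prod C A B)"
    and "Pr1 C A B \<cdot> h = f" "Pr2 C A B \<cdot> h = g"
  shows "h = \<langle>f, g\<rangle>"
  using product_ex1[OF assms(1,2)] pair_Hom[OF assms(1,2)] assms(3-5) by blast

lemma pair_Comp:
  assumes f: "f \<in> Hom C Z A" and g: "g \<in> Hom C Z B" and k: "k \<in> Hom C W Z"
  shows "\<langle>f, g\<rangle> \<cdot> k = \<langle>f \<cdot> k, g \<cdot> k\<rangle>"
proof (rule pair_unique)
  have A: "A \<in> Obj C" and B: "B \<in> Obj C" using f g Hom_Obj by blast+
  note fg = pair_Hom[OF f g]
  show "f \<cdot> k \<in> Hom C W A" "g \<cdot> k \<in> Hom C W B" "\<langle>f, g\<rangle> \<cdot> k \<in> Hom C W (Prod C A B)"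
    using Comp_Hom k f g fg(1) by blast+
  show "Pr1 C A B \<cdot> (\<langle>f, g\<rangle> \<cdot> k) = f \<cdot> k"
    using Comp_assoc[OF k fg(1) Pr_Hom(1)[OF A B]] fg(2) by simp
  show "Pr2 C A B \<cdot> (\<langle>f, g\<rangle> \<cdot> k) = g \<cdot> k"
    using Comp_assoc[OF k fg(1) Pr_Hom(2)[OF A B]] fg(3) by simp
qed

lemma pair_Pr:
  assumes "A \<in> Obj C" "B \<in> Obj C"
  shows "\<langle>Pr1 C A B, Pr2 C A B\<rangle> = Ident C (Prod C A B)"
proof -
  note p = Pr_Hom[OF assms]
  show ?thesis
    using pair_unique[OF p Ident_Hom[OF Prod_Obj[OF assms]]] p Comp_Ident_right by simp
qed

lemma diag_Hom: "A \<in> Obj C \<Longrightarrow> diag C A \<in> Hom C A (Prod C A A)"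
  unfolding diag_def by (intro pair_Hom Ident_Hom)

lemma swap_Hom: "A \<in> Obj C \<Longrightarrow> swap C A \<in> Hom C (Prod C A A) (Prod C A A)"
  unfolding swap_def by (intro pair_Hom Pr_Hom)

lemma cross_eq:
  assumes "c \<in> Hom C X A"
  shows "cross C c c = \<langle>c \<cdot> Pr1 C X X, c \<cdot> Pr2 C X X\<rangle>"
  using assms by (simp add: cross_def Hom_def)

lemma cross_Hom:
  assumes "c \<in> Hom C X A"
  shows "cross C c c \<in> Hom C (Prod C X X) (Prod C A A)"
proof -
  have "X \<in> Obj C" using Hom_Obj assms by blast
  then show ?thesis
    unfolding cross_eq[OF assms] using assms by (blast intro: pair_Hom Comp_Hom Pr_Hom)
qed

lemma cross_pair:
  assumes c: "c \<in> Hom C X A" and f: "f \<in> Hom C Z X" and g: "g \<in> Hom C Z X"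
  shows "cross C c c \<cdot> \<langle>f, g\<rangle> = \<langle>c \<cdot> f, c \<cdot> g\<rangle>"
proof -
  have X: "X \<in> Obj C" using Hom_Obj c by blast
  note p = Pr_Hom[OF X X] and fg = pair_Hom[OF f g]
  have "cross C c c \<cdot> \<langle>f, g\<rangle> = \<langle>(c \<cdot> Pr1 C X X) \<cdot> \<langle>f, g\<rangle>, (c \<cdot> Pr2 C X X) \<cdot> \<langle>f, g\<rangle>\<rangle>"
    unfolding cross_eq[OF c] by (rule pair_Comp[OF Comp_Hom[OF p(1) c] Comp_Hom[OF p(2) c] fg(1)])
  then show ?thesis
    using Comp_assoc[OF fg(1) p(1) c] Comp_assoc[OF fg(1) p(2) c] fg by simp
qed

lemma cross_Comp:
  assumes c: "c \<in> Hom C X A" and g: "g \<in> Hom C Z X"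
  shows "cross C (c \<cdot> g) (c \<cdot> g) = cross C c c \<cdot> cross C g g"
proof -
  have Z: "Z \<in> Obj C" using Hom_Obj g by blast
  note p = Pr_Hom[OF Z Z]
  show ?thesis
    using cross_pair[OF c Comp_Hom[OF p(1) g] Comp_Hom[OF p(2) g]]
      Comp_assoc[OF p(1) g c] Comp_assoc[OF p(2) g c]
    by (simp add: cross_eq[OF g] cross_eq[OF Comp_Hom[OF g c]])
qed

lemma cross_Ident:
  assumes A: "A \<in> Obj C"
  shows "cross C (Ident C A) (Ident C A) = Ident C (Prod C A A)"
  using Pr_Hom[OF A A] pair_Pr[OF A A] Comp_Ident_left
  by (simp add: cross_eq[OF Ident_Hom[OF A]])

lemma cross_diag:
  assumes c: "c \<in> Hom C X A"
  shows "cross C c c \<cdot> diag C X = diag C A \<cdot> c"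
proof -
  have X: "X \<in> Obj C" and A: "A \<in> Obj C" using Hom_Obj c by blast+
  show ?thesis
    unfolding diag_def
    using cross_pair[OF c Ident_Hom[OF X] Ident_Hom[OF X]]
      pair_Comp[OF Ident_Hom[OF A] Ident_Hom[OF A] c] Comp_Ident_left[OF c] Comp_Ident_right[OF c]
    by simp
qed

lemma Pr_diag:
  assumes A: "A \<in> Obj C"
  shows "Pr1 C A A \<cdot> diag C A = Ident C A" "Pr2 C A A \<cdot> diag C A = Ident C A"
  unfolding diag_def using pair_Hom[OF Ident_Hom[OF A] Ident_Hom[OF A]] by auto

lemma swap_diag:
  assumes A: "A \<in> Obj C"
  shows "swap C A \<cdot> diag C A = diag C A"
  using pair_Comp[OF Pr_Hom(2,1)[OF A A] diag_Hom[OF A] ] A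
  by (simp add: swap_def Pr_diag) (simp add: diag_def)

lemma swap_cross:
  assumes c: "c \<in> Hom C X A"
  shows "swap C A \<cdot> cross C c c = cross C c c \<cdot> swap C X"
proof -
  have X: "X \<in> Obj C" and A: "A \<in> Obj C" using Hom_Obj c by blast+
  note p = Pr_Hom[OF X X]
  note cp = pair_Hom[OF Comp_Hom[OF p(1) c] Comp_Hom[OF p(2) c]]
  have "swap C A \<cdot> cross C c c = \<langle>c \<cdot> Pr2 C X X, c \<cdot> Pr1 C X X\<rangle>"
    using pair_Comp[OF Pr_Hom(2,1)[OF A A] cross_Hom[OF c]] cp
    by (simp add: swap_def cross_eq[OF c])
  then show ?thesis using cross_pair[OF c p(2,1)] by (simp add: swap_def)
qed

lemma Pr_3_Hom:
  assumes A: "A \<in> Obj C" and B: "B \<in> Obj C" and D: "D \<in> Obj C"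
  shows "Pr1_3 C A B D \<in> Hom C (Prod3 C A B D) A"
    and "Pr2_3 C A B D \<in> Hom C (Prod3 C A B D) B"
    and "Pr3_3 C A B D \<in> Hom C (Prod3 C A B D) D"
  unfolding Pr1_3_def Pr2_3_def Pr3_3_def Prod3_def
  using Comp_Hom[OF Pr_Hom(1)[OF Prod_Obj[OF A B] D]] Pr_Hom[OF A B]
    Pr_Hom(2)[OF Prod_Obj[OF A B] D] by auto

lemma triple_Hom:
  assumes f: "f \<in> Hom C Z A" and g: "g \<in> Hom C Z B" and h: "h \<in> Hom C Z D"
  shows "\<langle>\<langle>f, g\<rangle>, h\<rangle> \<in> Hom C Z (Prod3 C A B D)"
  unfolding Prod3_def by (intro pair_Hom f g h)

lemma Pr_3_triple:
  assumes f: "f \<in> Hom C Z A" and g: "g \<in> Hom C Z B" and h: "h \<in> Hom C Z D"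
  shows "Pr1_3 C A B D \<cdot> \<langle>\<langle>f, g\<rangle>, h\<rangle> = f"
    and "Pr2_3 C A B D \<cdot> \<langle>\<langle>f, g\<rangle>, h\<rangle> = g"
    and "Pr3_3 C A B D \<cdot> \<langle>\<langle>f, g\<rangle>, h\<rangle> = h"
proof -
  have A: "A \<in> Obj C" and B: "B \<in> Obj C" and D: "D \<in> Obj C"
    using Hom_Obj f g h by blast+
  note fg = pair_Hom[OF f g]
  note t = pair_Hom[OF fg(1) h]
  note q = Pr_Hom(1)[OF Prod_Obj[OF A B] D]
  show "Pr1_3 C A B D \<cdot> \<langle>\<langle>f, g\<rangle>, h\<rangle> = f"
    unfolding Pr1_3_def using Comp_assoc[OF t(1) q Pr_Hom(1)[OF A B]] t(2) fg(2) by simp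
  show "Pr2_3 C A B D \<cdot> \<langle>\<langle>f, g\<rangle>, h\<rangle> = g"
    unfolding Pr2_3_def using Comp_assoc[OF t(1) q Pr_Hom(2)[OF A B]] t(2) fg(3) by simp
  show "Pr3_3 C A B D \<cdot> \<langle>\<langle>f, g\<rangle>, h\<rangle> = h"
    unfolding Pr3_3_def using t(3) by simp
qed

end

section \<open>Reindexing\<close>

context infsl_functor
begin

lemma Fib_orders:
  assumes "A \<in> Obj C"
  shows "partial_order (Fib P A)" "weak_lower_semilattice (Fib P A)"
    "weak_partial_order_top (Fib P A)" "weak_partial_order (Fib P A)"
proof -
  interpret inf_semilattice "Fib P A" using Fib_infsl assms .
  show "partial_order (Fib P A)" "weak_lower_semilattice (Fib P A)"
    "weak_partial_order_top (Fib P A)" "weak_partial_order (Fib P A)"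
    by unfold_locales
qed

lemmas le_refl = weak_partial_order.le_refl[OF Fib_orders(4)]
  and le_trans = weak_partial_order.le_trans[OF Fib_orders(4)]
  and le_antisym = partial_order.le_antisym[OF Fib_orders(1)]
  and meet_closed = weak_lower_semilattice.meet_closed[OF Fib_orders(2)]
  and meet_left = weak_lower_semilattice.meet_left[OF Fib_orders(2)]
  and meet_right = weak_lower_semilattice.meet_right[OF Fib_orders(2)]
  and meet_greatest = weak_lower_semilattice.meet_le[OF Fib_orders(2)]
  and top_closed = weak_partial_order_top.top_closed[OF Fib_orders(3)]
  and top_higher = weak_partial_order_top.top_higher[OF Fib_orders(3)]

lemma meet_absorb:
  assumes A: "A \<in> Obj C" and x: "x \<in> carrier (Fib P A)" and y: "y \<in> carrier (Fib P A)"
    and le: "x \<sqsubseteq>\<^bsub>Fib P A\<^esub> y"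
  shows "x \<sqinter>\<^bsub>Fib P A\<^esub> y = x"
  by (intro le_antisym[OF A] meet_left[OF A] meet_greatest[OF A] le_refl[OF A] meet_closed[OF A] x y le)

lemma top_meet:
  assumes A: "A \<in> Obj C" and x: "x \<in> carrier (Fib P A)"
  shows "\<top>\<^bsub>Fib P A\<^esub> \<sqinter>\<^bsub>Fib P A\<^esub> x = x"
  using meet_absorb[OF A x top_closed[OF A] top_higher[OF A x]] by (simp add: meet_comm)

lemma top_le_iff:
  assumes A: "A \<in> Obj C" and x: "x \<in> carrier (Fib P A)"
  shows "\<top>\<^bsub>Fib P A\<^esub> \<sqsubseteq>\<^bsub>Fib P A\<^esub> x \<longleftrightarrow> x = \<top>\<^bsub>Fib P A\<^esub>"
  using le_antisym[OF A _ _ x] top_closed[OF A] top_higher[OF A x] le_refl[OF A] by metis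

lemma Act_closed:
  assumes "f \<in> Hom C A B" "\<alpha> \<in> carrier (Fib P B)"
  shows "Act P f \<alpha> \<in> carrier (Fib P A)"
  using Act_hom[OF assms(1)] assms(2) by (auto simp: infsl_hom_def)

lemma Act_top: "f \<in> Hom C A B \<Longrightarrow> Act P f \<top>\<^bsub>Fib P B\<^esub> = \<top>\<^bsub>Fib P A\<^esub>"
  using Act_hom by (auto simp: infsl_hom_def)

lemma Act_meet:
  assumes "f \<in> Hom C A B" "\<alpha> \<in> carrier (Fib P B)" "\<beta> \<in> carrier (Fib P B)"
  shows "Act P f (\<alpha> \<sqinter>\<^bsub>Fib P B\<^esub> \<beta>) = Act P f \<alpha> \<sqinter>\<^bsub>Fib P A\<^esub> Act P f \<beta>"
  using Act_hom[OF assms(1)] assms(2,3) by (auto simp: infsl_hom_def)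

lemma Act_mono:
  assumes f: "f \<in> Hom C A B" and a: "\<alpha> \<in> carrier (Fib P B)" and b: "\<beta> \<in> carrier (Fib P B)"
    and le: "\<alpha> \<sqsubseteq>\<^bsub>Fib P B\<^esub> \<beta>"
  shows "Act P f \<alpha> \<sqsubseteq>\<^bsub>Fib P A\<^esub> Act P f \<beta>"
proof -
  have A: "A \<in> Obj C" and B: "B \<in> Obj C" using Hom_Obj[OF f] by auto
  have "Act P f \<alpha> = Act P f \<alpha> \<sqinter>\<^bsub>Fib P A\<^esub> Act P f \<beta>"
    using Act_meet[OF f a b] meet_absorb[OF B a b le] by simp
  then show ?thesis
    using meet_right[OF A Act_closed[OF f a] Act_closed[OF f b]] by simp
qed

end

section \<open>The equality predicate and equivalence relations\<close>

context elementary_doctrine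
begin

text \<open>The left adjoint of reindexing along the diagonal sends \<open>\<top>\<close> to \<open>\<delta>\<^sub>A\<close>, so \<open>\<delta>\<^sub>A\<close> is the least
  reflexive relation.\<close>

lemma delta_le_iff:
  assumes A: "A \<in> Obj C" and b: "\<beta> \<in> carrier (Fib P (Prod C A A))"
  shows "\<delta> A \<sqsubseteq>\<^bsub>Fib P (Prod C A A)\<^esub> \<beta> \<longleftrightarrow> Act P (diag C A) \<beta> = \<top>\<^bsub>Fib P A\<^esub>"
proof -
  have AA: "Prod C A A \<in> Obj C" using Prod_Obj[OF A A] .
  show ?thesis
    using galois_connection.galois_property[OF adjoint_diag[OF A], of "\<top>\<^bsub>Fib P A\<^esub>" \<beta>]
      b top_closed[OF A] Act_top[OF Pr_Hom(1)[OF A A]] top_meet[OF AA delta_closed[OF A]]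
      top_le_iff[OF A Act_closed[OF diag_Hom[OF A] b]]
    by simp
qed

lemma Act_diag_delta:
  assumes A: "A \<in> Obj C"
  shows "Act P (diag C A) (\<delta> A) = \<top>\<^bsub>Fib P A\<^esub>"
  using delta_le_iff[OF A delta_closed[OF A]] le_refl[OF Prod_Obj[OF A A] delta_closed[OF A]] by simp

lemma delta_le_Act_cross_delta:
  assumes c: "c \<in> Hom C X A"
  shows "\<delta> X \<sqsubseteq>\<^bsub>Fib P (Prod C X X)\<^esub> Act P (cross C c c) (\<delta> A)"
proof -
  have X: "X \<in> Obj C" and A: "A \<in> Obj C" using Hom_Obj[OF c] by auto
  note d = delta_closed[OF A]
  have "Act P (diag C X) (Act P (cross C c c) (\<delta> A)) = Act P c (Act P (diag C A) (\<delta> A))"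
    using Act_Comp[OF diag_Hom[OF X] cross_Hom[OF c] d] Act_Comp[OF c diag_Hom[OF A] d]
    by (simp add: cross_diag[OF c])
  also have "\<dots> = \<top>\<^bsub>Fib P X\<^esub>" by (simp add: Act_diag_delta[OF A] Act_top[OF c])
  finally show ?thesis by (simp add: delta_le_iff[OF X Act_closed[OF cross_Hom[OF c] d]])
qed

text \<open>Every predicate respects equality: \<open>\<D>es\<^bsub>\<delta>\<^sub>A\<^esub>\<close> is all of \<open>P(A)\<close>.\<close>

lemma descent_delta:
  assumes A: "A \<in> Obj C" and a: "\<alpha> \<in> carrier (Fib P A)"
  shows "\<alpha> \<in> carrier (Des C P A (\<delta> A))"
proof -
  have "Act P (diag C A) (Act P (Pr2 C A A) \<alpha>) = \<alpha>"
    using Act_Comp[OF diag_Hom[OF A] Pr_Hom(2)[OF A A] a] by (simp add: Pr_diag[OF A] Act_Ident[OF A a])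
  then have "Act P (Pr1 C A A) \<alpha> \<sqinter>\<^bsub>Fib P (Prod C A A)\<^esub> \<delta> A \<sqsubseteq>\<^bsub>Fib P (Prod C A A)\<^esub> Act P (Pr2 C A A) \<alpha>"
    using galois_connection.left[OF adjoint_diag[OF A], of \<alpha> "Act P (Pr2 C A A) \<alpha>"]
      a Act_closed[OF Pr_Hom(2)[OF A A] a] le_refl[OF A a] by simp
  then show ?thesis using a by (simp add: Des_def)
qed

text \<open>Transitivity is the substitution \<open>\<delta>(x, y) \<and> y = z \<le> \<delta>(x, z)\<close>. The parametrised adjunction
  reduces it to the instance \<open>z := y\<close>, where both sides are \<open>\<delta>(x, y)\<close>.\<close>

lemma delta_equivalence:
  assumes A: "A \<in> Obj C"
  shows "is_P_equivalence C P \<delta> A (\<delta> A)"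
proof -
  note d = delta_closed[OF A] and AA = Prod_Obj[OF A A] and p = Pr_Hom[OF A A]
    and r = Pr_3_Hom[OF A A A]
  have "Act P (diag C A) (Act P (swap C A) (\<delta> A)) = \<top>\<^bsub>Fib P A\<^esub>"
    using Act_Comp[OF diag_Hom[OF A] swap_Hom[OF A] d] by (simp add: swap_diag[OF A] Act_diag_delta[OF A])
  then have sym: "\<delta> A \<sqsubseteq>\<^bsub>Fib P (Prod C A A)\<^esub> Act P (swap C A) (\<delta> A)"
    by (simp add: delta_le_iff[OF A Act_closed[OF swap_Hom[OF A] d]])
  let ?e = "\<langle>\<langle>Pr1 C A A, Pr2 C A A\<rangle>, Pr2 C A A\<rangle>"
  let ?q = "\<langle>Pr1_3 C A A A, Pr3_3 C A A A\<rangle>"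
  have e: "?e \<in> Hom C (Prod C A A) (Prod3 C A A A)"
    by (rule triple_Hom[OF p(1,2,2)])
  have q: "?q \<in> Hom C (Prod3 C A A A) (Prod C A A)" by (rule pair_Hom(1)[OF r(1,3)])
  have "?q \<cdot> ?e = Ident C (Prod C A A)"
    using pair_Comp[OF r(1,3) e] Pr_3_triple[OF p(1,2,2)] by (simp add: pair_Pr[OF A A])
  then have "Act P ?e (Act P ?q (\<delta> A)) = \<delta> A"
    using Act_Comp[OF e q d] Act_Ident[OF AA d] by simp
  then have "Act P \<langle>Pr1_3 C A A A, Pr2_3 C A A A\<rangle> (\<delta> A)
       \<sqinter>\<^bsub>Fib P (Prod3 C A A A)\<^esub> Act P \<langle>Pr2_3 C A A A, Pr3_3 C A A A\<rangle> (\<delta> A)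
       \<sqsubseteq>\<^bsub>Fib P (Prod3 C A A A)\<^esub> Act P ?q (\<delta> A)"
    using galois_connection.left[OF adjoint_diag_param[OF A A], of "\<delta> A" "Act P ?q (\<delta> A)"]
      d Act_closed[OF q d] le_refl[OF AA d] by simp
  then show ?thesis
    using d sym le_refl[OF AA d] by (simp add: is_P_equivalence_def)
qed

text \<open>Transitivity at arbitrary generalised elements is the generic instance, reindexed along
  \<open>\<langle>\<langle>f, g\<rangle>, h\<rangle>\<close>. This form makes transitivity of a restricted relation the case of the
  generalised elements \<open>c \<cdot> pr\<^sub>i\<close>.\<close>

lemma equivalence_trans:
  assumes \<rho>: "is_P_equivalence C P \<delta> A \<rho>"
    and f: "f \<in> Hom C Z A" and g: "g \<in> Hom C Z A" and h: "h \<in> Hom C Z A"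
  shows "Act P \<langle>f, g\<rangle> \<rho> \<sqinter>\<^bsub>Fib P Z\<^esub> Act P \<langle>g, h\<rangle> \<rho> \<sqsubseteq>\<^bsub>Fib P Z\<^esub> Act P \<langle>f, h\<rangle> \<rho>"
proof -
  have A: "A \<in> Obj C" and Z: "Z \<in> Obj C" using Hom_Obj[OF f] by auto
  have c: "\<rho> \<in> carrier (Fib P (Prod C A A))" using \<rho> by (simp add: is_P_equivalence_def)
  note r = Pr_3_Hom[OF A A A] and t = triple_Hom[OF f g h] and u = Pr_3_triple[OF f g h]
  have pull: "Act P \<langle>\<langle>f, g\<rangle>, h\<rangle> (Act P \<langle>x, y\<rangle> \<rho>) = Act P \<langle>x \<cdot> \<langle>\<langle>f, g\<rangle>, h\<rangle>, y \<cdot> \<langle>\<langle>f, g\<rangle>, h\<rangle>\<rangle> \<rho>"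
    if "x \<in> Hom C (Prod3 C A A A) A" "y \<in> Hom C (Prod3 C A A A) A" for x y
    using Act_Comp[OF t pair_Hom(1)[OF that] c] pair_Comp[OF that t] by simp
  note cl = Act_closed[OF pair_Hom(1) c]
  have T: "Prod3 C A A A \<in> Obj C" using Hom_Obj[OF t] by simp
  show ?thesis
    using Act_mono[OF t meet_closed[OF T cl[OF r(1,2)] cl[OF r(2,3)]] cl[OF r(1,3)]]
      \<rho> Act_meet[OF t cl[OF r(1,2)] cl[OF r(2,3)]]
    by (simp add: is_P_equivalence_def pull[OF r(1,2)] pull[OF r(2,3)] pull[OF r(1,3)] u)
qed

lemma restricted_equivalence:
  assumes c: "c \<in> Hom C X A" and \<rho>: "is_P_equivalence C P \<delta> A \<rho>"
  shows "is_P_equivalence C P \<delta> X (Act P (cross C c c) \<rho>)"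
proof -
  have X: "X \<in> Obj C" and A: "A \<in> Obj C" using Hom_Obj[OF c] by auto
  note cc = cross_Hom[OF c] and XX = Prod_Obj[OF X X] and r = Pr_3_Hom[OF X X X]
  have car: "\<rho> \<in> carrier (Fib P (Prod C A A))"
    and refl: "\<delta> A \<sqsubseteq>\<^bsub>Fib P (Prod C A A)\<^esub> \<rho>"
    and sym: "\<rho> \<sqsubseteq>\<^bsub>Fib P (Prod C A A)\<^esub> Act P (swap C A) \<rho>"
    using \<rho> by (simp_all add: is_P_equivalence_def)
  have 1: "\<delta> X \<sqsubseteq>\<^bsub>Fib P (Prod C X X)\<^esub> Act P (cross C c c) \<rho>"
    by (rule le_trans[OF XX delta_le_Act_cross_delta[OF c] Act_mono[OF cc delta_closed[OF A] car refl]
        delta_closed[OF X] Act_closed[OF cc delta_closed[OF A]] Act_closed[OF cc car]])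
  have 2: "Act P (cross C c c) \<rho> \<sqsubseteq>\<^bsub>Fib P (Prod C X X)\<^esub> Act P (swap C X) (Act P (cross C c c) \<rho>)"
    using Act_mono[OF cc car Act_closed[OF swap_Hom[OF A] car] sym]
      Act_Comp[OF cc swap_Hom[OF A] car] Act_Comp[OF swap_Hom[OF X] cc car]
    by (simp add: swap_cross[OF c])
  have pull: "Act P \<langle>x, y\<rangle> (Act P (cross C c c) \<rho>) = Act P \<langle>c \<cdot> x, c \<cdot> y\<rangle> \<rho>"
    if "x \<in> Hom C Z X" "y \<in> Hom C Z X" for x y Z
    using Act_Comp[OF pair_Hom(1)[OF that] cc car] cross_pair[OF c that] by simp
  show ?thesis
    using 1 2 Act_closed[OF cc car]
      equivalence_trans[OF \<rho> Comp_Hom[OF r(1) c] Comp_Hom[OF r(2) c] Comp_Hom[OF r(3) c]]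
    by (simp add: is_P_equivalence_def pull[OF r(1,2)] pull[OF r(2,3)] pull[OF r(1,3)])
qed

section \<open>Comprehensions of descent data\<close>

text \<open>Since \<open>\<top>\<close> is a descent datum, the condition \<open>P\<^sub>f(\<alpha>) = \<top>\<close> means the same in \<open>P\<close> and in \<open>(P)\<^sub>q\<close>.\<close>

lemma Des_top:
  assumes A: "A \<in> Obj C" and \<rho>: "\<rho> \<in> carrier (Fib P (Prod C A A))"
  shows "\<top>\<^bsub>Des C P A \<rho>\<^esub> = \<top>\<^bsub>Fib P A\<^esub>"
proof -
  note AA = Prod_Obj[OF A A] and p = Pr_Hom[OF A A]
  have mem: "\<top>\<^bsub>Fib P A\<^esub> \<in> carrier (Des C P A \<rho>)"
    using top_closed[OF A] Act_top[OF p(1)] Act_top[OF p(2)] top_meet[OF AA \<rho>] top_higher[OF AA \<rho>]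
    by (simp add: Des_def)
  have le: "x \<sqsubseteq>\<^bsub>Des C P A \<rho>\<^esub> y \<longleftrightarrow> x \<sqsubseteq>\<^bsub>Fib P A\<^esub> y" for x y by (simp add: Des_def)
  have sub: "carrier (Des C P A \<rho>) \<subseteq> carrier (Fib P A)" by (auto simp: Des_def)
  show ?thesis
    unfolding top_def[of "Des C P A \<rho>"]
  proof (rule some_equality)
    show "greatest (Des C P A \<rho>) \<top>\<^bsub>Fib P A\<^esub> (carrier (Des C P A \<rho>))"
      using mem sub top_higher[OF A] by (auto simp: greatest_def le)
  next
    fix x assume "greatest (Des C P A \<rho>) x (carrier (Des C P A \<rho>))"
    then show "x = \<top>\<^bsub>Fib P A\<^esub>"
      using mem sub top_le_iff[OF A] by (auto simp: greatest_def le)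
  qed
qed

lemma RCat_Hom_iff:
  "m \<in> Hom (RCat C P \<delta>) (A, \<rho>) (B, \<sigma>) \<longleftrightarrow>
     (\<exists>f. m = ((A, \<rho>), f, (B, \<sigma>)) \<and> is_P_equivalence C P \<delta> A \<rho> \<and> is_P_equivalence C P \<delta> B \<sigma> \<and>
       f \<in> Hom C A B \<and> \<rho> \<sqsubseteq>\<^bsub>Fib P (Prod C A A)\<^esub> Act P (cross C f f) \<sigma>)"
  unfolding Hom_def[of "RCat C P \<delta>"] using Hom_Obj by (auto simp: RCat_def)

lemma RCat_Comp: "((B, \<sigma>), g, (D, \<tau>)) \<cdot>\<^bsub>RCat C P \<delta>\<^esub> ((A, \<rho>), f, (B, \<sigma>)) = ((A, \<rho>), g \<cdot> f, (D, \<tau>))"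
  by (simp add: RCat_def)

text \<open>With the restricted relation on \<open>X\<close>, compatibility of a factor \<open>g\<close> is the same condition as
  compatibility of \<open>c \<cdot> g\<close>, by functoriality of \<open>P\<close>.\<close>

lemma comprehension_lift:
  assumes comp: "is_comprehension C P A \<alpha> X c" and \<rho>: "is_P_equivalence C P \<delta> A \<rho>"
    and \<alpha>: "\<alpha> \<in> carrier (Des C P A \<rho>)"
  shows "is_comprehension (RCat C P \<delta>) (Pq C P) (A, \<rho>) \<alpha>
    (X, Act P (cross C c c) \<rho>) ((X, Act P (cross C c c) \<rho>), c, (A, \<rho>))"
proof -
  let ?\<sigma> = "Act P (cross C c c) \<rho>" and ?R = "RCat C P \<delta>"
  have c: "c \<in> Hom C X A" and A: "A \<in> Obj C" and top: "Act P c \<alpha> = \<top>\<^bsub>Fib P X\<^esub>"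
    and univ: "\<And>Z f. \<lbrakk>f \<in> Hom C Z A; Act P f \<alpha> = \<top>\<^bsub>Fib P Z\<^esub>\<rbrakk> \<Longrightarrow> \<exists>!g. g \<in> Hom C Z X \<and> f = c \<cdot> g"
    using comp by (auto simp: is_comprehension_def)
  have X: "X \<in> Obj C" using Hom_Obj[OF c] by simp
  have car: "\<rho> \<in> carrier (Fib P (Prod C A A))" using \<rho> by (simp add: is_P_equivalence_def)
  note \<sigma> = restricted_equivalence[OF c \<rho>] and cl = Act_closed[OF cross_Hom[OF c] car]
  have arrow: "((X, ?\<sigma>), c, (A, \<rho>)) \<in> Hom ?R (X, ?\<sigma>) (A, \<rho>)"
    using c \<rho> \<sigma> le_refl[OF Prod_Obj[OF X X] cl] by (simp add: RCat_Hom_iff)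
  have "\<exists>!g. g \<in> Hom ?R (Z, \<zeta>) (X, ?\<sigma>) \<and> m = ((X, ?\<sigma>), c, (A, \<rho>)) \<cdot>\<^bsub>?R\<^esub> g"
    if m: "m \<in> Hom ?R (Z, \<zeta>) (A, \<rho>)" and mtop: "Act (Pq C P) m \<alpha> = \<top>\<^bsub>Fib (Pq C P) (Z, \<zeta>)\<^esub>"
    for Z \<zeta> m
  proof -
    obtain f where f: "m = ((Z, \<zeta>), f, (A, \<rho>))" "is_P_equivalence C P \<delta> Z \<zeta>" "f \<in> Hom C Z A"
      "\<zeta> \<sqsubseteq>\<^bsub>Fib P (Prod C Z Z)\<^esub> Act P (cross C f f) \<rho>"
      using m by (auto simp: RCat_Hom_iff)
    have Z: "Z \<in> Obj C" using Hom_Obj[OF f(3)] by simp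
    have "Act P f \<alpha> = \<top>\<^bsub>Fib P Z\<^esub>"
      using mtop Des_top[OF Z] f(1,2) by (simp add: Pq_def is_P_equivalence_def)
    from univ[OF f(3) this] obtain g where g: "g \<in> Hom C Z X" "f = c \<cdot> g"
      and uniq: "\<And>g'. \<lbrakk>g' \<in> Hom C Z X; f = c \<cdot> g'\<rbrakk> \<Longrightarrow> g' = g" by blast
    have "\<zeta> \<sqsubseteq>\<^bsub>Fib P (Prod C Z Z)\<^esub> Act P (cross C g g) ?\<sigma>"
      using f(4) Act_Comp[OF cross_Hom[OF g(1)] cross_Hom[OF c] car] g(2) cross_Comp[OF c g(1)]
      by simp
    then have "((Z, \<zeta>), g, (X, ?\<sigma>)) \<in> Hom ?R (Z, \<zeta>) (X, ?\<sigma>)"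
      using g(1) f(2) \<sigma> by (simp add: RCat_Hom_iff)
    then show ?thesis
      using f(1) g(2) uniq by (intro ex1I[of _ "((Z, \<zeta>), g, (X, ?\<sigma>))"])
        (auto simp: RCat_Hom_iff RCat_Comp)
  qed
  moreover have "(A, \<rho>) \<in> Obj ?R" using A \<rho> by (simp add: RCat_def)
  moreover have "Act P c \<alpha> = \<top>\<^bsub>Des C P X ?\<sigma>\<^esub>" using top Des_top[OF X cl] by simp
  ultimately show ?thesis
    using arrow \<alpha> by (simp add: is_comprehension_def) (simp add: Pq_def)
qed

lemma has_comprehensions_Pq:
  assumes "has_comprehensions C P"
  shows "has_comprehensions (RCat C P \<delta>) (Pq C P)"
  unfolding has_comprehensions_def
proof (intro ballI)
  fix a \<alpha> assume a: "a \<in> Obj (RCat C P \<delta>)" "\<alpha> \<in> carrier (Fib (Pq C P) a)"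
  obtain A \<rho> where A: "a = (A, \<rho>)" "A \<in> Obj C" "is_P_equivalence C P \<delta> A \<rho>"
    "\<alpha> \<in> carrier (Des C P A \<rho>)"
    using a by (auto simp: RCat_def Pq_def)
  have "\<alpha> \<in> carrier (Fib P A)" using A(4) by (simp add: Des_def)
  then obtain X c where "is_comprehension C P A \<alpha> X c"
    using assms A(2) unfolding has_comprehensions_def by blast
  from comprehension_lift[OF this A(3,4)]
  show "\<exists>X c. is_comprehension (RCat C P \<delta>) (Pq C P) a \<alpha> X c" using A(1) by blast
qed

text \<open>A comprehension is monic: \<open>c \<cdot> g\<close> satisfies \<open>\<alpha>\<close> because \<open>c\<close> does, so it has only one
  factorisation through \<open>c\<close>.\<close>

lemma comprehension_cancel:
  assumes comp: "is_comprehension C P A \<alpha> X c"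
    and g: "g \<in> Hom C Z X" and h: "h \<in> Hom C Z X" and eq: "c \<cdot> g = c \<cdot> h"
  shows "g = h"
proof -
  have c: "c \<in> Hom C X A" and a: "\<alpha> \<in> carrier (Fib P A)" and top: "Act P c \<alpha> = \<top>\<^bsub>Fib P X\<^esub>"
    using comp by (auto simp: is_comprehension_def)
  have "Act P (c \<cdot> g) \<alpha> = \<top>\<^bsub>Fib P Z\<^esub>"
    using Act_Comp[OF g c a] top Act_top[OF g] by simp
  then have "\<exists>!k. k \<in> Hom C Z X \<and> c \<cdot> g = c \<cdot> k"
    using comp Comp_Hom[OF g c] by (auto simp: is_comprehension_def)
  then show ?thesis using g h eq by blast
qed

lemma J_comprehension_iff:
  assumes comp: "is_comprehension C P A \<alpha> X c"
  shows "is_comprehension (RCat C P \<delta>) (Pq C P) (J_obj \<delta> A) (j_map A \<alpha>) (J_obj \<delta> X) (J_arr C \<delta> c)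
    \<longleftrightarrow> \<delta> X = Act P (cross C c c) (\<delta> A)" (is "?J \<longleftrightarrow> ?E")
proof -
  let ?\<sigma> = "Act P (cross C c c) (\<delta> A)" and ?R = "RCat C P \<delta>"
  have c: "c \<in> Hom C X A" and A: "A \<in> Obj C" and a: "\<alpha> \<in> carrier (Fib P A)"
    using comp by (auto simp: is_comprehension_def)
  have X: "X \<in> Obj C" using Hom_Obj[OF c] by simp
  have Jc: "J_arr C \<delta> c = ((X, \<delta> X), c, (A, \<delta> A))"
    using c by (simp add: J_arr_def J_obj_def Hom_def)
  have lift: "is_comprehension ?R (Pq C P) (A, \<delta> A) \<alpha> (X, ?\<sigma>) ((X, ?\<sigma>), c, (A, \<delta> A))"
    by (rule comprehension_lift[OF comp delta_equivalence[OF A] descent_delta[OF A a]])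
  show ?thesis
  proof
    assume ?E
    then show ?J using lift by (simp add: Jc J_obj_def j_map_def)
  next
    assume J: ?J
    have "((X, ?\<sigma>), c, (A, \<delta> A)) \<in> Hom ?R (X, ?\<sigma>) (A, \<delta> A)"
      "Act (Pq C P) ((X, ?\<sigma>), c, (A, \<delta> A)) \<alpha> = \<top>\<^bsub>Fib (Pq C P) (X, ?\<sigma>)\<^esub>"
      using lift by (auto simp: is_comprehension_def)
    then obtain m where m: "m \<in> Hom ?R (X, ?\<sigma>) (X, \<delta> X)"
      and fact: "((X, ?\<sigma>), c, (A, \<delta> A)) = ((X, \<delta> X), c, (A, \<delta> A)) \<cdot>\<^bsub>?R\<^esub> m"
      using J unfolding is_comprehension_def Jc J_obj_def j_map_def by blast
    obtain g where g: "m = ((X, ?\<sigma>), g, (X, \<delta> X))" "g \<in> Hom C X X"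
      and le: "?\<sigma> \<sqsubseteq>\<^bsub>Fib P (Prod C X X)\<^esub> Act P (cross C g g) (\<delta> X)"
      using m by (auto simp: RCat_Hom_iff)
    have "c \<cdot> g = c \<cdot> Ident C X" using fact g(1) Comp_Ident_right[OF c] by (simp add: RCat_Comp)
    then have "g = Ident C X" by (rule comprehension_cancel[OF comp g(2) Ident_Hom[OF X]])
    then have "?\<sigma> \<sqsubseteq>\<^bsub>Fib P (Prod C X X)\<^esub> \<delta> X"
      using le Act_Ident[OF Prod_Obj[OF X X] delta_closed[OF X]] by (simp add: cross_Ident[OF X])
    then show ?E
      by (rule le_antisym[OF Prod_Obj[OF X X] delta_le_Act_cross_delta[OF c] _ delta_closed[OF X]
            Act_closed[OF cross_Hom[OF c] delta_closed[OF A]]])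
  qed
qed

end

theorem lemma4p6:
  fixes C :: "('o, 'm) product_category"
    and P :: "('o, 'm, 'p) doctrine"
    and \<delta> :: "'o \<Rightarrow> 'p"
  assumes "elementary_doctrine C P \<delta>"
  shows "(has_comprehensions C P \<longrightarrow> has_comprehensions (RCat C P \<delta>) (Pq C P)) \<and>
    (\<forall>A \<alpha> X c. is_comprehension C P A \<alpha> X c \<longrightarrow>
       (is_comprehension (RCat C P \<delta>) (Pq C P) (J_obj \<delta> A) (j_map A \<alpha>) (J_obj \<delta> X) (J_arr C \<delta> c)
          \<longleftrightarrow> \<delta> X = Act P (cross C c c) (\<delta> A)))"
  using elementary_doctrine.has_comprehensions_Pq[OF assms]
    elementary_doctrine.J_comprehension_iff[OF assms] by blast

end
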